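(* Let $f$ and $g$ be transcendental entire functions of bounded type which are permutable, i.e. $f\circ g=g\circ f$. Then $\overline{I(f)}$ and $\overline{I(g)}$ are completely invariant under $f\circ g$ (a set $E$ is completely invariant under $h$ if $z\in E \iff h(z)\in E$).
   Context: For an entire function $f$, $f^n$ denotes the $n$-th iterate and $I(f)=\{z\in\mathbb{C}: f^n(z)\to\infty\}$ is its escaping set; $\overline{E}$ denotes closure in $\mathbb{C}$. A transcendental entire function is of bounded type if the set of its critical values and finite asymptotic values, together with their finite limit points, is bounded. *)

theory Defs
  imports "HOL-Analysis.Analysis" "HOL-Computational_Algebra.Polynomial"
begin

definition entire :: "(complex \<Rightarrow> complex) \<Rightarrow> bool" where
  "entire f \<longleftrightarrow> f holomorphic_on UNIV"

definition transcendental_entire :: "(complex \<Rightarrow> complex) \<Rightarrow> bool" where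
  "transcendental_entire f \<longleftrightarrow> entire f \<and> \<not> (\<exists>p. \<forall>z. f z = poly p z)"

definition critical_values :: "(complex \<Rightarrow> complex) \<Rightarrow> complex set" where
  "critical_values f = {f z | z. deriv f z = 0}"

definition asymptotic_values :: "(complex \<Rightarrow> complex) \<Rightarrow> complex set" where
  "asymptotic_values f = {a. \<exists>\<gamma> :: real \<Rightarrow> complex.
      continuous_on {0..} \<gamma> \<and> filterlim \<gamma> at_infinity at_top \<and>
      ((\<lambda>t. f (\<gamma> t)) \<longlongrightarrow> a) at_top}"

definition singular_values :: "(complex \<Rightarrow> complex) \<Rightarrow> complex set" where
  "singular_values f = closure (critical_values f \<union> asymptotic_values f)"

definition bounded_type :: "(complex \<Rightarrow> complex) \<Rightarrow> bool" where
  "bounded_type f \<longleftrightarrow> transcendental_entire f \<and> bounded (singular_values f)"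

definition escaping_set :: "(complex \<Rightarrow> complex) \<Rightarrow> complex set" where
  "escaping_set f = {z. filterlim (\<lambda>n. (f ^^ n) z) at_infinity sequentially}"

definition completely_invariant :: "complex set \<Rightarrow> (complex \<Rightarrow> complex) \<Rightarrow> bool" where
  "completely_invariant E h \<longleftrightarrow> (\<forall>z. z \<in> E \<longleftrightarrow> h z \<in> E)"

end

theory Submission
  imports Defs "HOL-Complex_Analysis.Complex_Analysis"
begin

text \<open>
  Let \<open>h\<close> be a nonconstant entire function commuting with \<open>f\<close> (below, \<open>h = f \<circ> g\<close>). If \<open>h(z)\<close> escapes
  under \<open>f\<close>, then so does \<open>z\<close>, because \<open>h\<close> is bounded on bounded sets; as \<open>h\<close> is open, the
  preimage of the closure of \<open>I(f)\<close> lies in that closure. Conversely, if \<open>z\<close> is in the closure but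
  \<open>h(z)\<close> is not, then near \<open>z\<close> there is an escaping point \<open>a\<close> and a disc around \<open>a\<close> on which all
  iterates \<open>f\<^sup>n\<close> omit the set \<open>h\<^sup>-\<^sup>1(I(f))\<close>, which has at least two points by Picard's theorem. By
  Schottky and Harnack, \<open>f\<^sup>n \<rightarrow> \<infinity>\<close> uniformly near \<open>a\<close>.

  Functions of bounded type do not allow this (Eremenko and Lyubich). If all singular values lie in
  the closed disc of radius \<open>R\<close>, then exp on the half-plane \<open>Re \<zeta> > ln R\<close> lifts through \<open>f\<close> to a
  map \<open>G\<close>. The image of \<open>log G\<close> contains no disc of radius greater than \<open>\<pi>\<close>, since otherwise \<open>G\<close> is
  periodic and \<open>f\<close> is a polynomial. Bloch's theorem thus yields
  \<open>ln |f(z)| - ln R \<le> 12 \<pi> |z f'(z) / f(z)|\<close>. Hence the logarithmic derivatives \<open>D\<^sub>n\<close> of the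
  iterates at a fixed point of the disc tend to infinity and satisfy
  \<open>|D\<^sub>n\<^sub>+\<^sub>1| \<ge> c ln |f\<^sup>n\<^sup>+\<^sup>1| |D\<^sub>n|\<close>, whereas the Schwarz lemma for the half-plane bounds
  \<open>|D\<^sub>n\<^sub>+\<^sub>1|\<close> by a constant multiple of \<open>ln |f\<^sup>n\<^sup>+\<^sup>1|\<close>.
\<close>

section \<open>Lifting through an entire function\<close>

text \<open>Serves twice: for continuations on discs along a circle and for lifts on concentric
  discs. The pointwise choice of an index is harmless since the pieces agree on overlaps.\<close>

lemma holomorphic_glue:
  fixes h :: "'i \<Rightarrow> complex \<Rightarrow> complex"
  assumes S: "\<And>i. i \<in> I \<Longrightarrow> open (S i)" and h: "\<And>i. i \<in> I \<Longrightarrow> h i holomorphic_on S i"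
    and eq: "\<And>i j x. \<lbrakk>i \<in> I; j \<in> I; x \<in> S i; x \<in> S j\<rbrakk> \<Longrightarrow> h i x = h j x"
  obtains g where "g holomorphic_on (\<Union>i\<in>I. S i)" "\<And>i x. \<lbrakk>i \<in> I; x \<in> S i\<rbrakk> \<Longrightarrow> g x = h i x"
proof -
  define g where "g x = h (SOME i. i \<in> I \<and> x \<in> S i) x" for x
  have g: "g x = h i x" if "i \<in> I" "x \<in> S i" for i x
  proof -
    have "(SOME i. i \<in> I \<and> x \<in> S i) \<in> I \<and> x \<in> S (SOME i. i \<in> I \<and> x \<in> S i)"
      by (rule someI_ex) (use that in blast)
    then show ?thesis
      unfolding g_def using that eq by blast
  qed
  have "g holomorphic_on S i" if "i \<in> I" for i
    using h[OF that] g[OF that] by (metis holomorphic_cong)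
  then have "g holomorphic_on (\<Union>i\<in>I. S i)"
    using S by (intro holomorphic_on_UN_open) auto
  with g that show thesis by blast
qed

lemma holomorphic_local_inverse:
  assumes f: "f holomorphic_on UNIV" and "deriv f z \<noteq> 0"
  obtains r e \<psi> where "r > 0" "e > 0" "\<psi> holomorphic_on ball (f z) e"
    "\<And>w. w \<in> ball (f z) e \<Longrightarrow> f (\<psi> w) = w"
    "\<And>x. \<lbrakk>x \<in> ball z r; f x \<in> ball (f z) e\<rbrakk> \<Longrightarrow> \<psi> (f x) = x"
proof -
  obtain r where r: "r > 0" "open (f ` ball z r)" "inj_on f (ball z r)"
    using has_complex_derivative_locally_invertible[OF f _ _ assms(2)] by auto
  have "f holomorphic_on ball z r"
    using f holomorphic_on_subset by blast
  then obtain \<psi> where \<psi>: "\<psi> holomorphic_on f ` ball z r" "\<And>x. x \<in> ball z r \<Longrightarrow> \<psi> (f x) = x"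
    using holomorphic_has_inverse[OF _ open_ball r(3)] by metis
  obtain e where e: "e > 0" "ball (f z) e \<subseteq> f ` ball z r"
    using r by (metis centre_in_ball imageI openE)
  show thesis
  proof (rule that[of r e \<psi>])
    show "\<psi> holomorphic_on ball (f z) e"
      using \<psi>(1) e(2) holomorphic_on_subset by blast
  qed (use e r \<psi> in auto)
qed

text \<open>Local injectivity of \<open>f\<close> at \<open>G a\<close> forces \<open>G\<close> and
  \<open>H\<close> to agree near \<open>a\<close>; the identity theorem carries this over the
  connected set \<open>S\<close>.\<close>

lemma lift_unique:
  assumes f: "f holomorphic_on UNIV" and S: "open S" "connected S" "a \<in> S"
    and G: "G holomorphic_on S" "H holomorphic_on S"
    and eq: "\<And>x. x \<in> S \<Longrightarrow> f (G x) = f (H x)" and "G a = H a" and "deriv f (G a) \<noteq> 0"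
    and "x \<in> S"
  shows "G x = H x"
proof -
  obtain r where r: "r > 0" "inj_on f (ball (G a) r)"
    using has_complex_derivative_locally_injective[OF f _ _ assms(9)] by auto
  define T where "T = S \<inter> G -` ball (G a) r \<inter> (S \<inter> H -` ball (G a) r)"
  have "open T"
    unfolding T_def using G S(1)
    by (intro open_Int[OF continuous_open_preimage continuous_open_preimage])
      (auto intro: holomorphic_on_imp_continuous_on)
  moreover have "a \<in> T" "T \<subseteq> S"
    using \<open>a \<in> S\<close> r \<open>G a = H a\<close> by (auto simp: T_def)
  moreover have "G y = H y" if "y \<in> T" for y
    using that eq[of y] inj_onD[OF r(2)] by (auto simp: T_def)
  ultimately show ?thesis
    using analytic_continuation_open[of T S G H x] S G \<open>x \<in> S\<close> by blast
qed

text \<open>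
  The lift along the radius to \<open>a\<close> cannot tend to infinity, since then \<open>p a\<close> would be an asymptotic
  value; at a finite accumulation point, the local inverse of \<open>f\<close> continues it.
\<close>

lemma lift_extends_at_boundary:
  assumes f: "f holomorphic_on UNIV" and p: "p holomorphic_on ball 0 1"
    and crit: "\<And>z. f z \<in> p ` ball 0 1 \<Longrightarrow> deriv f z \<noteq> 0"
    and asym: "asymptotic_values f \<inter> p ` ball 0 1 = {}"
    and G: "G holomorphic_on ball 0 r" "\<And>x. x \<in> ball 0 r \<Longrightarrow> f (G x) = p x"
    and r: "0 < r" "r < 1" and a: "norm a = r"
  obtains d h where "d > 0" "h holomorphic_on ball a d" "ball a d \<subseteq> ball 0 1"
    "\<And>x. x \<in> ball a d \<Longrightarrow> f (h x) = p x" "\<And>x. x \<in> ball a d \<inter> ball 0 r \<Longrightarrow> h x = G x"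
proof -
  \<comment> \<open>The radius towards \<open>a\<close>, parametrised over \<open>{0..}\<close> to
    match the paths in \<open>asymptotic_values\<close>.\<close>
  define c where "c s = of_real (s / (1 + s)) * a" for s :: real
  have c_in: "c s \<in> ball 0 r" if "s \<ge> 0" for s
  proof -
    have "norm (c s) = (s / (1 + s)) * r"
      unfolding c_def using that a by (simp only: norm_mult norm_of_real) auto
    also have "\<dots> < r"
      using that r by (simp add: field_simps)
    finally show ?thesis by simp
  qed
  have "((\<lambda>s::real. s / (1 + s)) \<longlongrightarrow> 1) at_top"
    by real_asymp
  then have "(c \<longlongrightarrow> of_real 1 * a) at_top"
    unfolding c_def by (intro tendsto_intros)
  then have c_lim: "(c \<longlongrightarrow> a) at_top" by simp
  have a1: "a \<in> ball 0 1" using a r by simp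
  have contp: "continuous_on (ball 0 1) p"
    using p holomorphic_on_imp_continuous_on by blast
  then have "isCont p a"
    using a1 continuous_on_eq_continuous_at open_ball by blast
  then have pc: "((\<lambda>s. p (c s)) \<longlongrightarrow> p a) at_top"
    using c_lim isCont_tendsto_compose by blast
  have ev: "eventually (\<lambda>s::real. s \<ge> 0) at_top"
    by (rule eventually_ge_at_top)
  have fG: "((\<lambda>s. f (G (c s))) \<longlongrightarrow> p a) at_top"
    by (rule Lim_transform_eventually[OF pc]) (use ev in \<open>eventually_elim, use G c_in in auto\<close>)
  have contG: "continuous_on {0..} (\<lambda>s. G (c s))"
  proof (rule continuous_on_compose2[of "ball 0 r" G])
    show "continuous_on {0..} c"
      unfolding c_def by (intro continuous_intros) auto
  qed (use c_in G holomorphic_on_imp_continuous_on in auto)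
  \<comment> \<open>Otherwise \<open>G \<circ> c\<close> would be a path to infinity along which
    \<open>f\<close> tends to \<open>p a\<close>, which \<open>asym\<close> excludes.\<close>
  have "\<not> filterlim (\<lambda>s. G (c s)) at_infinity at_top"
    using asym a1 fG contG by (auto simp: asymptotic_values_def)
  then obtain B where B: "B > 0" "\<not> eventually (\<lambda>s. B \<le> norm (G (c s))) at_top"
    unfolding filterlim_at_infinity[OF order_refl] by auto
  then have "\<exists>s \<ge> real n. norm (G (c s)) < B" for n
    by (auto simp: eventually_at_top_linorder not_le)
  then obtain s where s: "\<And>n. s n \<ge> real n" "\<And>n. norm (G (c (s n))) < B"
    by metis
  have "\<forall>n. G (c (s n)) \<in> cball 0 B"
    using s(2) by (auto simp: less_imp_le)
  then obtain z q where z: "strict_mono q" "((\<lambda>n. G (c (s n))) \<circ> q) \<longlonglongrightarrow> z"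
    using compact_cball[of 0 B] unfolding compact_def by metis
  have slim: "filterlim (\<lambda>n. s (q n)) at_top sequentially"
    by (rule filterlim_at_top_mono[OF filterlim_real_sequentially])
       (use s z(1) in \<open>auto intro!: always_eventually order.trans[OF _ s(1)] seq_suble\<close>)
  have "(\<lambda>n. f (G (c (s (q n))))) \<longlonglongrightarrow> p a"
    using filterlim_compose[OF fG slim] by simp
  moreover have "isCont f z"
    using f continuous_on_eq_continuous_at holomorphic_on_imp_continuous_on open_UNIV by blast
  then have "(\<lambda>n. f (G (c (s (q n))))) \<longlonglongrightarrow> f z"
    using isCont_tendsto_compose z(2) by (fastforce simp: o_def)
  ultimately have fz: "f z = p a"
    using LIMSEQ_unique by blast
  then have "deriv f z \<noteq> 0"
    using crit a1 by auto
  then obtain r0 e \<psi> where \<psi>: "r0 > 0" "e > 0" "\<psi> holomorphic_on ball (f z) e"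
    "\<And>w. w \<in> ball (f z) e \<Longrightarrow> f (\<psi> w) = w"
    "\<And>x. \<lbrakk>x \<in> ball z r0; f x \<in> ball (f z) e\<rbrakk> \<Longrightarrow> \<psi> (f x) = x"
    using holomorphic_local_inverse[OF f] by metis
  have "open (ball 0 1 \<inter> p -` ball (p a) e)"
    by (rule continuous_open_preimage[OF contp]) auto
  then obtain d where d: "d > 0" "ball a d \<subseteq> ball 0 1 \<inter> p -` ball (p a) e"
    using a1 \<open>e > 0\<close> by (metis IntI centre_in_ball openE vimage_eq)
  define h where "h = \<psi> \<circ> p"
  have hh: "h holomorphic_on ball a d"
    unfolding h_def
    by (rule holomorphic_on_compose_gen[of _ _ _ "ball (f z) e"])
       (use \<psi> p d fz holomorphic_on_subset in auto)
  have fh: "f (h x) = p x" if "x \<in> ball a d" for x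
    using that d(2) fz \<psi>(4)[of "p x"] by (auto simp: h_def)
  \<comment> \<open>For large \<open>n\<close> the lifted point lies where \<open>\<psi>\<close>
    inverts \<open>f\<close>, and the point below it lies in the new disc. So \<open>h\<close> and
    \<open>G\<close> agree at one common point, which suffices by uniqueness of lifts.\<close>
  have "eventually (\<lambda>n. G (c (s (q n))) \<in> ball z r0) sequentially"
    using z(2) \<psi>(1) by (auto simp: o_def tendsto_iff dist_commute)
  moreover have "(\<lambda>n. c (s (q n))) \<longlonglongrightarrow> a"
    using filterlim_compose[OF c_lim slim] by simp
  then have "eventually (\<lambda>n. c (s (q n)) \<in> ball a d) sequentially"
    using d(1) by (auto simp: tendsto_iff dist_commute)
  ultimately obtain n where n: "G (c (s (q n))) \<in> ball z r0" "c (s (q n)) \<in> ball a d"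
    using eventually_happens'[OF sequentially_bot eventually_conj] by blast
  define b where "b = c (s (q n))"
  have "s (q n) \<ge> 0" using s(1)[of "q n"] by simp
  then have b: "b \<in> ball a d \<inter> ball 0 r"
    using n c_in by (auto simp: b_def)
  have hb: "h b = G b"
    using \<psi>(5)[of "G b"] n G(2)[of b] b d(2) fz by (auto simp: h_def b_def)
  have "h x = G x" if "x \<in> ball a d \<inter> ball 0 r" for x
  proof (rule lift_unique[OF f, where S = "ball a d \<inter> ball 0 r" and a = b and G = h and H = G])
    show "connected (ball a d \<inter> ball 0 r)"
      by (intro convex_connected convex_Int convex_ball)
    show "deriv f (h b) \<noteq> 0"
      using crit[of "h b"] fh[of b] b d(2) by auto
    show "h holomorphic_on ball a d \<inter> ball 0 r" "G holomorphic_on ball a d \<inter> ball 0 r"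
      using hh G(1) holomorphic_on_subset by blast+
    show "f (h y) = f (G y)" if "y \<in> ball a d \<inter> ball 0 r" for y
      using fh[of y] G(2)[of y] that by simp
  qed (use b hb that in auto)
  then show thesis using that[OF d(1) hh _ fh] d(2) by blast
qed

text \<open>
  Two local continuations on intersecting discs are compared at such a common point inside the
  circle, where both agree with the lift.
\<close>

lemma balls_meet_inside:
  fixes a b :: complex
  assumes "norm a = r" "norm b = r" "a \<noteq> b" "x \<in> ball a d" "x \<in> ball b e"
  obtains y where "y \<in> ball a d \<inter> ball b e \<inter> ball 0 r"
proof -
  have de: "d > 0" "e > 0" "dist a b < d + e"
    using assms dist_triangle_less_add[of a x d b e] by (auto simp: dist_commute intro: le_less_trans[OF zero_le_dist])
  define t where "t = d / (d + e)"
  have t: "0 < t" "t < 1" using de by (auto simp: t_def)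
  define y where "y = (1 - t) *\<^sub>R a + t *\<^sub>R b"
  have "y - a = t *\<^sub>R (b - a)" "y - b = (1 - t) *\<^sub>R (a - b)"
    by (auto simp: y_def algebra_simps)
  then have "dist a y = t * dist a b" "dist b y = (1 - t) * dist a b"
    using t by (simp_all add: dist_norm norm_minus_commute[of a] norm_minus_commute[of b y])
  moreover have "t * dist a b < d" "(1 - t) * dist a b < e"
    using mult_strict_left_mono[OF de(3,1)] mult_strict_left_mono[OF de(3,2)] de
    by (auto simp: t_def field_simps)
  moreover have "norm y < r"
  proof -
    have "y \<in> open_segment a b"
      using t assms(3) by (auto simp: in_segment y_def)
    then have "dist 0 y < dist 0 a \<or> dist 0 y < dist 0 b"
      using dist_decreases_open_segment by blast
    then show ?thesis using assms by simp
  qed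
  ultimately show thesis using that[of y] by auto
qed

text \<open>Every point of the circle has a disc of continuation, and any two of these continuations
  are compatible. Compactness of the closed disc turns them into one larger radius.\<close>

lemma lift_extends:
  assumes f: "f holomorphic_on UNIV" and p: "p holomorphic_on ball 0 1"
    and crit: "\<And>z. f z \<in> p ` ball 0 1 \<Longrightarrow> deriv f z \<noteq> 0"
    and asym: "asymptotic_values f \<inter> p ` ball 0 1 = {}"
    and G: "G holomorphic_on ball 0 r" "\<And>x. x \<in> ball 0 r \<Longrightarrow> f (G x) = p x"
    and r: "0 < r" "r < 1"
  obtains r' H where "r < r'" "r' \<le> 1" "H holomorphic_on ball 0 r'"
    "\<And>x. x \<in> ball 0 r' \<Longrightarrow> f (H x) = p x" "\<And>x. x \<in> ball 0 r \<Longrightarrow> H x = G x"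
proof -
  have "\<exists>d h. d > 0 \<and> h holomorphic_on ball a d \<and> ball a d \<subseteq> ball 0 1 \<and>
    (\<forall>x\<in>ball a d. f (h x) = p x) \<and> (\<forall>x\<in>ball a d \<inter> ball 0 r. h x = G x)" if "norm a = r" for a :: complex
    using lift_extends_at_boundary[OF f p crit asym G r that] by metis
  then obtain d h where dh: "\<And>a. norm a = r \<Longrightarrow> d a > 0 \<and> h a holomorphic_on ball a (d a) \<and>
      ball a (d a) \<subseteq> ball 0 1 \<and>
      (\<forall>x\<in>ball a (d a). f (h a x) = p x) \<and> (\<forall>x\<in>ball a (d a) \<inter> ball 0 r. h a x = G x)"
    by metis
  \<comment> \<open>The index 0 is free to stand for the old lift on \<open>ball 0 r\<close>,
    because \<open>r > 0\<close> keeps 0 off the circle.\<close>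
  define I :: "complex set" where "I = insert 0 (sphere 0 r)"
  define S where "S a = (if a = 0 then ball 0 r else ball a (d a))" for a :: complex
  define k where "k a = (if a = 0 then G else h a)" for a :: complex
  have I: "a = 0 \<or> a \<noteq> 0 \<and> norm a = r" if "a \<in> I" for a :: complex
    using that r by (auto simp: I_def)
  have kG: "k a x = G x" if "a \<in> I" "x \<in> S a" "x \<in> ball 0 r" for a x
    using I[OF that(1)] dh[of a] that by (auto simp: k_def S_def)
  have fk: "f (k a x) = p x" if "a \<in> I" "x \<in> S a" for a x
    using I[OF that(1)] dh[of a] that G(2)[of x] by (auto simp: k_def S_def)
  have So: "open (S a)" for a
    by (simp add: S_def)
  have kh: "k a holomorphic_on S a" if "a \<in> I" for a
    using I[OF that(1)] dh[of a] G(1) unfolding S_def k_def by presburger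
  have eq: "k a x = k b x" if "a \<in> I" "b \<in> I" "x \<in> S a" "x \<in> S b" for a b x
  proof (cases "a = 0 \<or> b = 0 \<or> a = b")
    case True
    then have "x \<in> ball 0 r \<or> a = b"
      using that(3,4) by (auto simp: S_def)
    then show ?thesis
      using kG[OF that(1,3)] kG[OF that(2,4)] by metis
  next
    case False
    then have ab: "norm a = r" "norm b = r" "x \<in> ball a (d a)" "x \<in> ball b (d b)"
      using that I by (auto simp: S_def)
    then obtain y where y: "y \<in> ball a (d a) \<inter> ball b (d b) \<inter> ball 0 r"
      using balls_meet_inside False by blast
    have "h a x = h b x"
    proof (rule lift_unique[OF f, where S = "ball a (d a) \<inter> ball b (d b)" and a = y
          and G = "h a" and H = "h b"])
      show "connected (ball a (d a) \<inter> ball b (d b))"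
        by (intro convex_connected convex_Int convex_ball)
      show "h a holomorphic_on ball a (d a) \<inter> ball b (d b)" "h b holomorphic_on ball a (d a) \<inter> ball b (d b)"
        using dh[OF ab(1)] dh[OF ab(2)] holomorphic_on_subset by blast+
      have "f (h a y) = p y" "y \<in> ball 0 1" using dh[OF ab(1)] y by blast+
      then show "deriv f (h a y) \<noteq> 0"
        using crit by blast
      have "h a y = G y" "h b y = G y" using dh[OF ab(1)] dh[OF ab(2)] y by blast+
      then show "h a y = h b y" by simp
      show "f (h a w) = f (h b w)" if "w \<in> ball a (d a) \<inter> ball b (d b)" for w
        using dh[OF ab(1)] dh[OF ab(2)] that by (metis IntE)
      show "y \<in> ball a (d a) \<inter> ball b (d b)" "x \<in> ball a (d a) \<inter> ball b (d b)"
        using y ab by blast+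
    qed auto
    then show ?thesis using False by (simp add: k_def)
  qed
  obtain H where H: "H holomorphic_on (\<Union>a\<in>I. S a)" "\<And>a x. \<lbrakk>a \<in> I; x \<in> S a\<rbrakk> \<Longrightarrow> H x = k a x"
    using holomorphic_glue[of I S k] So kh eq by metis
  have "cball 0 r \<subseteq> (\<Union>a\<in>I. S a)"
  proof
    fix x :: complex assume "x \<in> cball 0 r"
    then consider "norm x < r" | "norm x = r" unfolding mem_cball_0 by linarith
    then show "x \<in> (\<Union>a\<in>I. S a)"
    proof cases
      case 1
      then show ?thesis by (auto simp: I_def S_def)
    next
      case 2
      then have "x \<in> I" "x \<in> S x" using dh[of x] r by (auto simp: I_def S_def)
      then show ?thesis by blast
    qed
  qed
  moreover have "open (\<Union>a\<in>I. S a)" using So by blast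
  ultimately obtain e where e: "e > 0" "(\<Union>x\<in>cball 0 r. ball x e) \<subseteq> (\<Union>a\<in>I. S a)"
    using compact_subset_open_imp_ball_epsilon_subset[OF compact_cball] by metis
  \<comment> \<open>Capped at 1, since \<open>p\<close> is controlled only on the unit disc.\<close>
  define r' where "r' = min 1 (r + e)"
  have sub: "ball 0 r' \<subseteq> (\<Union>a\<in>I. S a)"
  proof -
    have "x \<in> (\<Union>x\<in>cball 0 r. ball x e)" if "norm x < r + e" for x :: complex
    proof (cases "norm x \<le> r")
      case True
      then show ?thesis using e(1) by (intro UN_I[of x]) auto
    next
      case False
      then have x0: "norm x > 0" using r by linarith
      \<comment> \<open>The radial projection of \<open>x\<close> to the circle, at distance
        \<open>norm x - r < e\<close> from \<open>x\<close>.\<close>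
      define y where "y = (r / norm x) *\<^sub>R x"
      have "norm y = r" using x0 r by (auto simp: y_def)
      have "y - x = (r / norm x - 1) *\<^sub>R x" by (simp add: y_def algebra_simps)
      then have "dist y x = \<bar>r / norm x - 1\<bar> * norm x" by (simp add: dist_norm)
      moreover have "r / norm x < 1" using x0 False by simp
      ultimately have "dist y x = (1 - r / norm x) * norm x" by simp
      then have "dist y x = norm x - r" using x0 by (simp add: left_diff_distrib)
      then have "x \<in> ball y e" using that by auto
      then show ?thesis using \<open>norm y = r\<close> by (intro UN_I[of y]) auto
    qed
    moreover have "norm x < r + e" if "x \<in> ball 0 r'" for x :: complex
      using that by (simp add: r'_def)
    ultimately show ?thesis using e(2) by blast
  qed
  show thesis
  proof (rule that[of r' H])
    show "r < r'" "r' \<le> 1" using e r by (auto simp: r'_def)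
    show "H holomorphic_on ball 0 r'" using H(1) sub holomorphic_on_subset by blast
    show "f (H x) = p x" if x: "x \<in> ball 0 r'" for x
    proof -
      obtain a where a: "a \<in> I" "x \<in> S a" using subsetD[OF sub x] by (rule UN_E)
      show ?thesis using H(2)[OF a] fk[OF a] by simp
    qed
    show "H x = G x" if "x \<in> ball 0 r" for x
      using H(2)[of 0 x] that by (auto simp: I_def S_def k_def)
  qed
qed

text \<open>Take the supremum \<open>s\<close> of the radii on which a lift starting at
  \<open>z0\<close> exists. By uniqueness these lifts glue to one on \<open>ball 0 s\<close>, and
  \<open>s < 1\<close> would contradict the extension across the circle.\<close>

lemma lift_through_unit_ball:
  assumes f: "f holomorphic_on UNIV" and p: "p holomorphic_on ball 0 1"
    and crit: "\<And>z. f z \<in> p ` ball 0 1 \<Longrightarrow> deriv f z \<noteq> 0"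
    and asym: "asymptotic_values f \<inter> p ` ball 0 1 = {}"
    and z0: "f z0 = p 0"
  obtains G where "G holomorphic_on ball 0 1" "G 0 = z0" "\<And>x. x \<in> ball 0 1 \<Longrightarrow> f (G x) = p x"
proof -
  define Q where "Q G r \<longleftrightarrow> G holomorphic_on ball 0 r \<and> G 0 = z0 \<and> (\<forall>x\<in>ball 0 r. f (G x) = p x)" for G r
  define A where "A = {r. 0 < r \<and> r \<le> 1 \<and> (\<exists>G. Q G r)}"
  have dz0: "deriv f z0 \<noteq> 0" using crit z0 by auto
  have "A \<noteq> {}"
  proof -
    obtain r0 e \<psi> where \<psi>: "r0 > 0" "e > 0" "\<psi> holomorphic_on ball (f z0) e"
      "\<And>w. w \<in> ball (f z0) e \<Longrightarrow> f (\<psi> w) = w"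
      "\<And>x. \<lbrakk>x \<in> ball z0 r0; f x \<in> ball (f z0) e\<rbrakk> \<Longrightarrow> \<psi> (f x) = x"
      using holomorphic_local_inverse[OF f dz0] by metis
    have "open (ball 0 1 \<inter> p -` ball (p 0) e)"
      by (rule continuous_open_preimage) (use p holomorphic_on_imp_continuous_on in auto)
    then obtain d where d: "d > 0" "ball 0 d \<subseteq> ball 0 1 \<inter> p -` ball (p 0) e"
      using \<open>e > 0\<close> by (metis IntI centre_in_ball openE vimage_eq zero_less_one)
    have "\<psi> \<circ> p holomorphic_on ball 0 (min 1 d)"
      by (rule holomorphic_on_compose_gen[of _ _ _ "ball (f z0) e"])
         (use \<psi> p d z0 holomorphic_on_subset in auto)
    moreover have "f ((\<psi> \<circ> p) x) = p x" if "x \<in> ball 0 (min 1 d)" for x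
      using that d(2) z0 \<psi>(4)[of "p x"] by auto
    moreover have "(\<psi> \<circ> p) 0 = z0"
      using \<psi>(5)[of z0] \<psi>(1,2) z0 by auto
    ultimately have "min 1 d \<in> A" using d(1) by (auto simp: A_def Q_def)
    then show ?thesis by blast
  qed
  have bdd: "bdd_above A" unfolding A_def by (rule bdd_aboveI[of _ 1]) auto
  define s where "s = Sup A"
  have s: "0 < s" "s \<le> 1"
  proof -
    obtain r where "r \<in> A" using \<open>A \<noteq> {}\<close> by blast
    then show "0 < s" using cSup_upper[OF _ bdd, of r] by (auto simp: s_def A_def)
    show "s \<le> 1" unfolding s_def using \<open>A \<noteq> {}\<close> by (intro cSup_least) (auto simp: A_def)
  qed
  obtain k where k: "\<And>r. r \<in> A \<Longrightarrow> Q (k r) r"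
  proof -
    have "\<forall>r\<in>A. \<exists>G. Q G r" by (auto simp: A_def)
    then show ?thesis using that by metis
  qed
  have eq: "k r x = k t x" if "r \<in> A" "t \<in> A" "x \<in> ball 0 r" "x \<in> ball 0 t" for r t x
  proof (rule lift_unique[OF f, where S = "ball 0 r \<inter> ball 0 t" and a = 0 and G = "k r" and H = "k t"])
    have rt: "0 < r" "0 < t" using that by (auto simp: A_def)
    have kr: "k r holomorphic_on ball 0 r" "k r 0 = z0" "\<forall>x\<in>ball 0 r. f (k r x) = p x"
      using k[OF that(1)] unfolding Q_def by blast+
    have kt: "k t holomorphic_on ball 0 t" "k t 0 = z0" "\<forall>x\<in>ball 0 t. f (k t x) = p x"
      using k[OF that(2)] unfolding Q_def by blast+
    show "connected (ball (0::complex) r \<inter> ball 0 t)"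
      by (intro convex_connected convex_Int convex_ball)
    show "x \<in> ball 0 r \<inter> ball 0 t" using that by blast
    show "k r holomorphic_on ball 0 r \<inter> ball 0 t" "k t holomorphic_on ball 0 r \<inter> ball 0 t"
      using holomorphic_on_subset[OF kr(1), of "ball 0 r \<inter> ball 0 t"]
        holomorphic_on_subset[OF kt(1), of "ball 0 r \<inter> ball 0 t"] by simp_all
    show "0 \<in> ball 0 r \<inter> ball 0 t" using rt by simp
    show "k r 0 = k t 0" "deriv f (k r 0) \<noteq> 0" using kr kt dz0 by simp_all
    show "f (k r y) = f (k t y)" if "y \<in> ball 0 r \<inter> ball 0 t" for y
      using kr(3) kt(3) that by simp
  qed auto
  obtain G where G: "G holomorphic_on (\<Union>r\<in>A. ball 0 r)" "\<And>r x. \<lbrakk>r \<in> A; x \<in> ball 0 r\<rbrakk> \<Longrightarrow> G x = k r x"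
    using holomorphic_glue[of A "ball 0" k] k eq by (metis open_ball Q_def)
  have "(\<Union>r\<in>A. ball 0 r) = ball (0::complex) s"
    using less_cSup_iff[OF \<open>A \<noteq> {}\<close> bdd] by (auto simp: s_def)
  have QG: "Q G s"
    unfolding Q_def
  proof (intro conjI ballI)
    show "G holomorphic_on ball 0 s" using G(1) \<open>(\<Union>r\<in>A. ball 0 r) = _\<close> by simp
    show "G 0 = z0" using \<open>A \<noteq> {}\<close> G(2) k by (force simp: A_def Q_def)
    fix x :: complex assume "x \<in> ball 0 s"
    then obtain r where "r \<in> A" "x \<in> ball 0 r" using \<open>(\<Union>r\<in>A. ball 0 r) = _\<close> by blast
    then show "f (G x) = p x" using G(2) k by (auto simp: Q_def)
  qed
  then have Gs: "G holomorphic_on ball 0 s" "G 0 = z0" "\<And>x. x \<in> ball 0 s \<Longrightarrow> f (G x) = p x"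
    unfolding Q_def by blast+
  have "s = 1"
  proof (rule ccontr)
    assume "s \<noteq> 1"
    then have "s < 1" using s by simp
    obtain r' H where H: "s < r'" "r' \<le> 1" "H holomorphic_on ball 0 r'"
      "\<And>x. x \<in> ball 0 r' \<Longrightarrow> f (H x) = p x" "\<And>x. x \<in> ball 0 s \<Longrightarrow> H x = G x"
      using lift_extends[OF f p crit asym Gs(1,3) s(1) \<open>s < 1\<close>] by metis
    have "H 0 = z0" using H(5)[of 0] Gs(2) s(1) by simp
    then have "Q H r'" unfolding Q_def using H by blast
    then have "r' \<in> A" unfolding A_def using H(1,2) s(1) by auto
    then show False using cSup_upper[OF _ bdd, of r'] H(1) by (simp add: s_def)
  qed
  show thesis using Gs[unfolded \<open>s = 1\<close>] by (rule that)
qed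

section \<open>Expansion in the logarithmic metric\<close>

text \<open>The Moebius map of the right half-plane to the unit disc that sends \<open>b\<close> to
  0. The squared moduli of denominator and numerator differ by
  \<open>4 * Re a * Re b > 0\<close>.\<close>

lemma half_plane_Moebius:
  assumes "0 < Re a" "0 < Re b"
  shows "norm ((a - b) / (a + cnj b)) < 1" and "a + cnj b \<noteq> 0"
proof -
  have "Re (a + cnj b) > 0" using assms by simp
  then show nz: "a + cnj b \<noteq> 0" by force
  have "(norm (a - b))\<^sup>2 + 4 * (Re a * Re b) = (norm (a + cnj b))\<^sup>2"
    unfolding cmod_power2 by (simp add: power2_eq_square algebra_simps)
  moreover have "Re a * Re b > 0" using assms by simp
  ultimately have "(norm (a - b))\<^sup>2 < (norm (a + cnj b))\<^sup>2" by linarith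
  then have "norm (a - b) < norm (a + cnj b)" by (rule power_less_imp_less_base) simp
  then show "norm ((a - b) / (a + cnj b)) < 1" using nz by (simp add: norm_divide)
qed

text \<open>The inverse of the preceding Moebius map: multiplied by the squared modulus of
  \<open>1 - x\<close>, its real part is \<open>Re b\<close> times one minus the squared modulus of
  \<open>x\<close>.\<close>

lemma half_plane_Moebius_inverse:
  assumes "0 < Re b" "norm x < 1"
  shows "0 < Re ((b + cnj b * x) / (1 - x))"
proof -
  have x: "1 - x \<noteq> 0" using assms by auto
  have "Re ((b + cnj b * x) * cnj (1 - x)) = Re b * (1 - (norm x)\<^sup>2)"
    unfolding cmod_power2 by (simp add: power2_eq_square algebra_simps)
  moreover have "(norm x)\<^sup>2 < 1" using assms by (simp add: power_less_one_iff)
  ultimately have "Re ((b + cnj b * x) * cnj (1 - x)) > 0" using assms by simp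
  then show ?thesis
    using x by (simp add: Re_divide_Reals Re_complex_div_gt_0)
qed

text \<open>A Moebius map transports the half-plane to the unit disc, where lifts exist; the values
  of exp there have modulus above \<open>R\<close> and so avoid all singular values.\<close>

lemma lift_exp_half_plane:
  assumes f: "f holomorphic_on UNIV" and R: "0 < R"
    and crit: "\<And>z. R < norm (f z) \<Longrightarrow> deriv f z \<noteq> 0"
    and asym: "\<And>a. a \<in> asymptotic_values f \<Longrightarrow> norm a \<le> R"
    and \<zeta>: "ln R < Re \<zeta>" and z: "f z = exp \<zeta>"
  obtains G where "G holomorphic_on {x. ln R < Re x}" "G \<zeta> = z"
    "\<And>x. ln R < Re x \<Longrightarrow> f (G x) = exp x"
proof -
  define l where "l = complex_of_real (ln R)"
  \<comment> \<open>Chosen so that the disc's centre corresponds to \<open>\<zeta>\<close>, that is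
    \<open>p 0 = exp \<zeta>\<close>.\<close>
  define b where "b = \<zeta> - l"
  have b: "0 < Re b" using \<zeta> by (simp add: b_def l_def)
  define p where "p x = exp (l + (b + cnj b * x) / (1 - x))" for x
  have p: "p holomorphic_on ball 0 1"
    unfolding p_def by (intro holomorphic_intros) auto
  have big: "R < norm w" if w: "w \<in> p ` ball 0 1" for w
  proof -
    obtain x where x: "norm x < 1" "w = p x" using w by auto
    have "exp (ln R) < exp (ln R + Re ((b + cnj b * x) / (1 - x)))"
      using half_plane_Moebius_inverse[OF b x(1)] by simp
    then show ?thesis
      using R by (simp add: x(2) p_def l_def)
  qed
  have "f z = p 0" by (simp add: p_def b_def z)
  then obtain G where G: "G holomorphic_on ball 0 1" "G 0 = z" "\<And>x. x \<in> ball 0 1 \<Longrightarrow> f (G x) = p x"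
    using lift_through_unit_ball[OF f p] crit asym big by (metis disjoint_iff not_less)
  define q where "q x = (x - l - b) / (x - l + cnj b)" for x
  have q: "norm (q x) < 1" "x - l + cnj b \<noteq> 0" if "ln R < Re x" for x
    using half_plane_Moebius[of "x - l" b] that b by (auto simp: q_def l_def)
  have pq: "p (q x) = exp x" if "ln R < Re x" for x
  proof -
    define d where "d = x - l + cnj b"
    have d: "d \<noteq> 0" using q(2)[OF that] by (simp add: d_def)
    have "b + cnj b \<noteq> 0" using b by (auto simp: complex_eq_iff)
    have "1 - q x = (b + cnj b) / d"
      using d by (simp add: q_def flip: d_def) (simp add: d_def field_simps)
    moreover have "b + cnj b * q x = (x - l) * (b + cnj b) / d"
      using d by (simp add: q_def flip: d_def) (simp add: d_def field_simps)
    ultimately have "(b + cnj b * q x) / (1 - q x) = x - l"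
      using d \<open>b + cnj b \<noteq> 0\<close> by simp
    then show ?thesis by (simp add: p_def)
  qed
  show thesis
  proof (rule that[of "G \<circ> q"])
    show "G \<circ> q holomorphic_on {x. ln R < Re x}"
    proof (rule holomorphic_on_compose_gen[OF _ G(1)])
      show "q holomorphic_on {x. ln R < Re x}"
        unfolding q_def using q(2) by (intro holomorphic_intros) auto
    qed (use q(1) in auto)
    show "(G \<circ> q) \<zeta> = z" by (simp add: q_def b_def G(2))
    show "f ((G \<circ> q) x) = exp x" if "ln R < Re x" for x
      using G(3)[of "q x"] q(1)[OF that] pq[OF that] by simp
  qed
qed

section \<open>Periodic lifts, logarithmic derivatives and half-plane estimates\<close>

lemma filterlim_at_infinity_imp_polynomial:
  assumes f: "f holomorphic_on UNIV" and lim: "filterlim f at_infinity at_infinity"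
  obtains p where "\<And>z. f z = poly p z"
proof -
  have "((inverse \<circ> f) \<longlongrightarrow> 0) at_infinity"
    unfolding o_def using filterlim_compose[OF tendsto_inverse_0 lim] .
  then obtain a n where a: "\<And>z. f z = (\<Sum>i\<le>n. a i * z ^ i)"
    using pole_at_infinity[OF f] by metis
  show thesis
    by (rule that[of "\<Sum>i\<le>n. monom (a i) i"]) (simp add: a poly_sum poly_monom)
qed

lemma periodic_shift:
  fixes G :: "complex \<Rightarrow> 'a"
  assumes "\<And>x. c < Re x \<Longrightarrow> G (x + \<i> * of_real T) = G x" "c < Re x"
  shows "G (x + \<i> * of_real (of_int k * T)) = G x"
proof -
  have nat: "G (x + \<i> * of_real (of_nat n * T)) = G x" if "c < Re x" for n :: nat and x
  proof (induction n)
    case (Suc n)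
    have "G (x + \<i> * of_real (of_nat (Suc n) * T)) = G ((x + \<i> * of_real (of_nat n * T)) + \<i> * of_real T)"
      by (simp add: algebra_simps)
    also have "\<dots> = G x"
      by (subst assms(1)) (use that Suc in auto)
    finally show ?case .
  qed simp
  show ?thesis
  proof (cases "k \<ge> 0")
    case True
    then show ?thesis using nat[OF assms(2), of "nat k"] by simp
  next
    case False
    have "G (x + \<i> * of_real (of_int k * T)) =
        G ((x + \<i> * of_real (of_int k * T)) + \<i> * of_real (of_nat (nat (- k)) * T))"
      by (rule nat[symmetric]) (use assms(2) in simp)
    also have "\<dots> = G x" using False by (simp add: algebra_simps)
    finally show ?thesis .
  qed
qed

text \<open>
  By periodicity the frontier of \<open>G {Re > s}\<close> lies in the image of a compact segment of the line
  \<open>Re = s\<close>, so this open unbounded set contains a neighbourhood of infinity.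
\<close>

lemma periodic_lift_imp_tendsto_infinity:
  assumes f: "f holomorphic_on UNIV" and T: "0 < T"
    and G: "G holomorphic_on {x. c < Re x}" "\<And>x. c < Re x \<Longrightarrow> f (G x) = exp x"
    and per: "\<And>x. c < Re x \<Longrightarrow> G (x + \<i> * of_real T) = G x"
  shows "filterlim f at_infinity at_infinity"
proof -
  have openH: "open {x. t < Re x}" "convex {x. t < Re x}" for t
    using open_halfspace_Re_gt convex_halfspace_Re_gt by auto
  have contG: "continuous_on {x. c < Re x} G"
    using G(1) holomorphic_on_imp_continuous_on by blast
  have contf: "continuous_on A f" for A
    using f holomorphic_on_imp_continuous_on continuous_on_subset by blast
  \<comment> \<open>Needed for the open mapping theorem below.\<close>
  have nonconst: "\<not> G constant_on {x. c < Re x}"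
  proof
    assume "G constant_on {x. c < Re x}"
    then have "G (of_real (c + 1)) = G (of_real (c + 2))"
      unfolding constant_on_def by auto
    then have "exp (complex_of_real (c + 1)) = exp (complex_of_real (c + 2))"
      using G(2)[of "of_real (c + 1)"] G(2)[of "of_real (c + 2)"] by simp
    then have "exp (c + 1) = exp (c + 2)"
      by (metis exp_of_real of_real_eq_iff)
    then show False by simp
  qed
  have main: "\<exists>M. \<forall>z. M < norm z \<longrightarrow> exp s < norm (f z)" if s: "c < s" for s
  proof -
    define W where "W = G ` {x. s < Re x}"
    define K where "K = G ` cbox (Complex s 0) (Complex s T)"
    have "open W"
      unfolding W_def using open_mapping_thm[OF G(1)] openH nonconst s
      by (metis (no_types, lifting) convex_connected Collect_mono order.strict_trans)
    have "compact K"
      unfolding K_def using s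
      by (intro compact_continuous_image continuous_on_subset[OF contG]) (auto simp: in_cbox_complex_iff)
    then obtain M where M: "\<And>z. z \<in> K \<Longrightarrow> norm z \<le> M"
      using compact_imp_bounded bounded_iff by metis
    have clos: "z \<in> W \<union> K" if z: "z \<in> closure W" for z
    proof -
      obtain w where w: "\<And>n. w n \<in> W" "w \<longlonglongrightarrow> z"
        using z unfolding closure_sequential by blast
      have "\<exists>x. s < Re x \<and> 0 \<le> Im x \<and> Im x \<le> T \<and> w n = G x" for n
      proof -
        obtain y where y: "s < Re y" "w n = G y" using w(1)[of n] by (auto simp: W_def)
        \<comment> \<open>The number of periods that moves the imaginary part into
          \<open>[0, T]\<close>.\<close>
        define k where "k = - \<lfloor>Im y / T\<rfloor>"
        have "0 \<le> Im y + of_int k * T" "Im y + of_int k * T \<le> T"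
          using floor_divide_lower[OF T, of "Im y"] floor_divide_upper[OF T, of "Im y"]
          by (auto simp: k_def algebra_simps)
        moreover have "G (y + \<i> * of_real (of_int k * T)) = G y"
          using periodic_shift[of c G T y k] per y s by simp
        ultimately show ?thesis
          using y by (intro exI[of _ "y + \<i> * of_real (of_int k * T)"]) auto
      qed
      then obtain x where x: "\<And>n. s < Re (x n)" "\<And>n. 0 \<le> Im (x n)" "\<And>n. Im (x n) \<le> T"
        "\<And>n. w n = G (x n)"
        by metis
      have "(\<lambda>n. f (w n)) \<longlonglongrightarrow> f z"
        using w(2) contf[of UNIV] by (simp add: continuous_on_eq_continuous_at isCont_tendsto_compose)
      then obtain B where B: "B > 0" "\<And>n. norm (f (w n)) \<le> B"
        using convergent_imp_Bseq[unfolded convergent_def] BseqE by metis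
      \<comment> \<open>The modulus of \<open>f (G x)\<close> is \<open>exp (Re x)\<close>, so
        convergence of \<open>f (w n)\<close> confines the representatives \<open>x n\<close> to a
        compact rectangle.\<close>
      have "Re (x n) \<le> ln B" for n
      proof -
        have "exp (Re (x n)) \<le> B"
          using B(2)[of n] x(1)[of n] s G(2)[of "x n"] by (simp add: x(4))
        then show ?thesis using B(1) by (simp add: ln_ge_iff)
      qed
      then have "\<forall>n. x n \<in> cbox (Complex s 0) (Complex (ln B) T)"
        using x less_imp_le[OF x(1)] by (auto simp: in_cbox_complex_iff)
      then obtain y q where y: "y \<in> cbox (Complex s 0) (Complex (ln B) T)" "strict_mono q" "(x \<circ> q) \<longlonglongrightarrow> y"
        using compact_cbox unfolding compact_def by metis
      have "isCont G y"
        using contG openH(1)[of c] y(1) s by (auto simp: continuous_on_eq_continuous_at in_cbox_complex_iff)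
      then have "(\<lambda>n. G (x (q n))) \<longlonglongrightarrow> G y"
        using y(3) isCont_tendsto_compose by (fastforce simp: o_def)
      moreover have "(\<lambda>n. G (x (q n))) \<longlonglongrightarrow> z"
        using LIMSEQ_subseq_LIMSEQ[OF w(2) y(2)] x(4) by (simp add: o_def)
      ultimately have "z = G y" using LIMSEQ_unique by blast
      show ?thesis
      proof (cases "s < Re y")
        case True
        then show ?thesis using \<open>z = G y\<close> by (auto simp: W_def)
      next
        case False
        then have "y \<in> cbox (Complex s 0) (Complex s T)"
          using y(1) by (auto simp: in_cbox_complex_iff)
        then show ?thesis using \<open>z = G y\<close> by (auto simp: K_def)
      qed
    qed
    define C :: "complex set" where "C = - cball 0 M"
    have "connected C"
      unfolding C_def
      by (rule connected_complement_bounded_convex) auto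
    have CK: "C \<inter> K = {}" using M by (auto simp: C_def)
    \<comment> \<open>If \<open>W\<close> lay in a disc, \<open>f\<close> would be bounded on
      \<open>W\<close>, yet \<open>f (G t) = exp t\<close> is unbounded for real
      \<open>t\<close>.\<close>
    have "W \<inter> C \<noteq> {}"
    proof
      assume "W \<inter> C = {}"
      then have sub: "W \<subseteq> cball 0 M" by (auto simp: C_def)
      have "compact (f ` cball 0 M)" by (intro compact_continuous_image contf compact_cball)
      then obtain B where B: "\<And>w. w \<in> cball 0 M \<Longrightarrow> norm (f w) \<le> B"
        using compact_imp_bounded bounded_iff by (metis imageI)
      define t where "t = max (s + 1) (ln (max 1 B + 1))"
      have "G (of_real t) \<in> W" by (auto simp: W_def t_def)
      then have "norm (f (G (of_real t))) \<le> B" using B sub by blast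
      then have "exp t \<le> B"
        using G(2)[of "of_real t"] s by (simp add: t_def)
      moreover have "exp (ln (max 1 B + 1)) \<le> exp t"
        unfolding exp_le_cancel_iff t_def by (rule max.cobounded2)
      then have "exp t \<ge> max 1 B + 1"
        by (subst (asm) exp_ln) auto
      ultimately show False by simp
    qed
    \<comment> \<open>Since \<open>C\<close> avoids \<open>K\<close>, the set \<open>W\<close> is
      both open and closed relative to the connected set \<open>C\<close>.\<close>
    have "C \<subseteq> W"
    proof (rule ccontr)
      assume "\<not> C \<subseteq> W"
      then have "C \<inter> - closure W \<noteq> {}" using clos CK by blast
      moreover have "C \<subseteq> W \<union> - closure W" using clos CK by blast
      moreover have "W \<inter> - closure W \<inter> C = {}" using closure_subset by blast
      ultimately show False
        using connectedD[OF \<open>connected C\<close> \<open>open W\<close>, of "- closure W"] \<open>W \<inter> C \<noteq> {}\<close> by blast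
    qed
    then have "exp s < norm (f z)" if "M < norm z" for z
    proof -
      have "z \<in> W" using that \<open>C \<subseteq> W\<close> by (auto simp: C_def)
      then show ?thesis using G(2) s by (auto simp: W_def)
    qed
    then show ?thesis by blast
  qed
  show ?thesis
    unfolding filterlim_at_infinity[OF order_refl]
  proof (intro allI impI)
    fix r :: real assume "r > 0"
    define s where "s = max (c + 1) (ln r)"
    have "c < s" by (auto simp: s_def less_max_iff_disj)
    then obtain M where M: "\<forall>z. M < norm z \<longrightarrow> exp s < norm (f z)" using main by blast
    have "exp (ln r) \<le> exp s" by (simp add: s_def)
    then have "r \<le> exp s" using \<open>r > 0\<close> by simp
    have "r \<le> norm (f z)" if "M + 1 \<le> norm z" for z
      using M that \<open>r \<le> exp s\<close> by (smt (verit))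
    then show "\<forall>\<^sub>F x in at_infinity. r \<le> norm (f x)"
      unfolding eventually_at_infinity by blast
  qed
qed

text \<open>If the estimate failed, Bloch's theorem would give \<open>F = log G\<close> an image
  disc of radius above \<open>pi\<close>. It contains two values differing by
  \<open>2 * pi * \<i>\<close>, where \<open>G\<close> takes the same value. Hence \<open>G\<close>
  is periodic and \<open>f\<close> a polynomial.\<close>

lemma log_derivative_lower_bound:
  assumes f: "transcendental_entire f" and R: "0 < R"
    and crit: "\<And>z. R < norm (f z) \<Longrightarrow> deriv f z \<noteq> 0"
    and asym: "\<And>a. a \<in> asymptotic_values f \<Longrightarrow> norm a \<le> R"
    and f0: "norm (f 0) \<le> R" and z: "R < norm (f z)"
  shows "ln (norm (f z)) - ln R \<le> 12 * pi * norm (z * deriv f z / f z)"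
proof (rule ccontr)
  assume neg: "\<not> ?thesis"
  have holf: "f holomorphic_on UNIV" using f by (simp add: transcendental_entire_def entire_def)
  have "f z \<noteq> 0" using z R by auto
  define \<zeta> where "\<zeta> = Ln (f z)"
  have \<zeta>: "exp \<zeta> = f z" "Re \<zeta> = ln (norm (f z))" "ln R < Re \<zeta>"
    using \<open>f z \<noteq> 0\<close> z R by (auto simp: \<zeta>_def)
  define H where "H = {x. ln R < Re x}"
  have H: "open H" "convex H" "\<zeta> \<in> H"
    using \<zeta> open_halfspace_Re_gt convex_halfspace_Re_gt by (auto simp: H_def)
  obtain G where G: "G holomorphic_on H" "G \<zeta> = z" "\<And>x. x \<in> H \<Longrightarrow> f (G x) = exp x"
    using lift_exp_half_plane[OF holf R crit asym \<zeta>(3) \<zeta>(1)[symmetric]] unfolding H_def by auto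
  have fG: "R < norm (f (G x))" if "x \<in> H" for x
  proof -
    have "exp (ln R) < exp (Re x)" using that by (simp add: H_def)
    then show ?thesis using G(3)[OF that] R by simp
  qed
  \<comment> \<open>This is where the bound on \<open>f 0\<close> enters: it keeps \<open>G\<close>
    away from 0, so that \<open>G\<close> has a logarithm.\<close>
  have G0: "G x \<noteq> 0" if "x \<in> H" for x
    using fG[OF that] f0 by auto
  then obtain F where F: "F holomorphic_on H" "\<And>x. x \<in> H \<Longrightarrow> G x = exp (F x)"
    using contractible_imp_holomorphic_log[OF G(1) convex_imp_contractible[OF H(2)]] by metis
  define D where "D = deriv F \<zeta>"
  have "(F has_field_derivative D) (at \<zeta>)"
    unfolding D_def using F(1) H holomorphic_derivI by blast
  then have "((\<lambda>x. exp (F x)) has_field_derivative exp (F \<zeta>) * D) (at \<zeta>)"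
    by (rule DERIV_fun_exp)
  moreover have Gd: "(G has_field_derivative deriv G \<zeta>) (at \<zeta>)"
    using G(1) H holomorphic_derivI by blast
  then have "((\<lambda>x. exp (F x)) has_field_derivative deriv G \<zeta>) (at \<zeta>)"
    by (rule has_field_derivative_transform_within_open[OF _ H(1,3)]) (use F(2) in auto)
  ultimately have D1: "deriv G \<zeta> = z * D"
    using DERIV_unique F(2)[OF H(3)] G(2) by metis
  have "(f has_field_derivative deriv f z) (at (G \<zeta>))"
    using holf G(2) holomorphic_derivI by blast
  then have "(f \<circ> G has_field_derivative deriv f z * deriv G \<zeta>) (at \<zeta>)"
    using Gd by (rule DERIV_chain)
  then have "(exp has_field_derivative deriv f z * deriv G \<zeta>) (at \<zeta>)"
    by (rule has_field_derivative_transform_within_open[OF _ H(1,3)]) (use G(3) in auto)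
  then have "deriv f z * deriv G \<zeta> = f z"
    using DERIV_unique DERIV_exp \<zeta>(1) by metis
  \<comment> \<open>In logarithmic coordinates \<open>F\<close> is a local inverse of
    \<open>f\<close>, so \<open>D\<close> is the reciprocal of the logarithmic derivative.\<close>
  then have D: "(z * deriv f z / f z) * D = 1"
    using \<open>f z \<noteq> 0\<close> D1 by (simp add: field_simps)
  define \<rho> where "\<rho> = Re \<zeta> - ln R"
  have "\<rho> > 0" using \<zeta>(3) by (simp add: \<rho>_def)
  have ball: "ball \<zeta> \<rho> \<subseteq> H"
  proof
    fix x assume "x \<in> ball \<zeta> \<rho>"
    then have "\<bar>Re (\<zeta> - x)\<bar> < \<rho>"
      using abs_Re_le_cmod[of "\<zeta> - x"] by (simp add: dist_norm)
    then show "x \<in> H" by (simp add: H_def \<rho>_def)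
  qed
  \<comment> \<open>The 12 is the constant in Bloch's theorem, applied on the largest disc about
    \<open>\<zeta>\<close> inside the half-plane.\<close>
  have "pi < \<rho> * norm D / 12"
  proof -
    have "12 * pi * norm (z * deriv f z / f z) < \<rho>"
      using neg by (simp add: \<rho>_def \<zeta>(2))
    moreover have "norm D > 0" using D by auto
    ultimately have "12 * pi * norm (z * deriv f z / f z) * norm D < \<rho> * norm D"
      by (rule mult_strict_right_mono)
    moreover have "norm (z * deriv f z / f z) * norm D = 1"
      using D by (metis norm_mult norm_one)
    ultimately have "12 * pi < \<rho> * norm D" by (metis mult.assoc mult.right_neutral)
    then show ?thesis by simp
  qed
  moreover obtain b where b: "ball b (\<rho> * norm D / 12) \<subseteq> F ` ball \<zeta> \<rho>"
    using Bloch[of F \<zeta> \<rho>] holomorphic_on_subset[OF F(1) ball] \<open>\<rho> > 0\<close> D_def by blast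
  moreover have "F ` ball \<zeta> \<rho> \<subseteq> F ` H" using ball by (rule image_mono)
  ultimately have "b - \<i> * pi \<in> F ` H" "b + \<i> * pi \<in> F ` H"
    by (auto simp: dist_norm norm_mult intro!: subsetD[OF \<open>F ` ball \<zeta> \<rho> \<subseteq> F ` H\<close>] subsetD[OF b])
  then obtain x1 x2 where x: "x1 \<in> H" "x2 \<in> H" "F x1 = b - \<i> * pi" "F x2 = b + \<i> * pi"
    by (metis imageE)
  have "exp (b + \<i> * pi) = exp (b - \<i> * pi)"
    by (simp add: exp_add exp_diff)
  then have Geq: "G x1 = G x2" using F(2) x by simp
  then have "exp x1 = exp x2" using G(3) x by metis
  then obtain n :: int where n: "x1 = x2 + of_int (2 * n) * pi * \<i>"
    using exp_eq by blast
  have "n \<noteq> 0" using x n by auto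
  \<comment> \<open>Start from whichever of \<open>x1\<close> and \<open>x2\<close> is lower, so
    that the period \<open>T\<close> is positive.\<close>
  have "\<exists>a\<in>H. \<exists>T>0. exp (\<i> * of_real T) = 1 \<and> G (a + \<i> * of_real T) = G a"
  proof (cases "n > 0")
    case True
    have "x1 = x2 + \<i> * of_real (2 * of_int n * pi)" using n by simp
    moreover have "exp (\<i> * of_real (2 * of_int n * pi)) = 1"
      using exp_eq_1[of "\<i> * of_real (2 * of_int n * pi)"] by simp
    ultimately show ?thesis using x Geq True
      by (intro bexI[of _ x2] exI[of _ "2 * of_int n * pi"]) auto
  next
    case False
    have "x2 = x1 + \<i> * of_real (- 2 * of_int n * pi)" using n by simp
    moreover have "exp (\<i> * of_real (- 2 * of_int n * pi)) = 1"
      unfolding exp_eq_1 by (auto intro: exI[of _ "- n"])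
    ultimately show ?thesis using x Geq False \<open>n \<noteq> 0\<close>
      by (intro bexI[of _ x1] exI[of _ "- 2 * of_int n * pi"]) (auto simp: mult_neg_pos)
  qed
  then obtain a T where a: "a \<in> H" "T > 0" "exp (\<i> * of_real T) = 1" "G (a + \<i> * of_real T) = G a"
    by blast
  \<comment> \<open>Both sides lift exp because \<open>T\<close> is a period of exp along the
    imaginary axis; they agree at \<open>a\<close>, hence on all of \<open>H\<close>.\<close>
  have "G (x + \<i> * of_real T) = G x" if "x \<in> H" for x
  proof (rule lift_unique[OF holf, where S = H and a = a and G = "\<lambda>x. G (x + \<i> * of_real T)" and H = G])
    show "connected H" using H(2) convex_connected by blast
    have "(G \<circ> (\<lambda>x. x + \<i> * of_real T)) holomorphic_on H"
      by (rule holomorphic_on_compose_gen[OF _ G(1)]) (auto intro!: holomorphic_intros simp: H_def)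
    then show "(\<lambda>x. G (x + \<i> * of_real T)) holomorphic_on H" by (simp add: o_def)
    show "f (G (y + \<i> * of_real T)) = f (G y)" if "y \<in> H" for y
      using G(3)[of y] G(3)[of "y + \<i> * of_real T"] that a(3) by (simp add: H_def exp_add)
    show "deriv f (G (a + \<i> * of_real T)) \<noteq> 0"
      using crit fG[OF a(1)] a(4) by simp
  qed (use H a G that in auto)
  then have "filterlim f at_infinity at_infinity"
    using periodic_lift_imp_tendsto_infinity[OF holf a(2), of G "ln R"] G(1,3) by (simp add: H_def)
  then show False
    using filterlim_at_infinity_imp_polynomial[OF holf] f unfolding transcendental_entire_def by metis
qed

text \<open>Rescale to the unit disc and follow \<open>h\<close> by the Moebius map sending
  \<open>h a\<close> to 0. The Schwarz lemma bounds the derivative at 0 and gives a Harnack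
  inequality on the disc of half the radius.\<close>

lemma half_plane_Schwarz:
  assumes h: "h holomorphic_on ball a r" and r: "0 < r" and pos: "\<And>x. x \<in> ball a r \<Longrightarrow> 0 < Re (h x)"
  shows "r * norm (deriv h a) \<le> 2 * Re (h a)"
    and "dist a x \<le> r / 2 \<Longrightarrow> Re (h a) \<le> 3 * Re (h x)"
proof -
  define b where "b = h a"
  have b: "0 < Re b" using pos[of a] r by (simp add: b_def)
  define k where "k x = h (a + of_real r * x)" for x
  define q where "q x = (k x - b) / (k x + cnj b)" for x
  have in_ball: "a + of_real r * x \<in> ball a r" if "norm x < 1" for x
    using that r by (simp add: dist_norm norm_mult)
  have k: "0 < Re (k x)" if "norm x < 1" for x
    using pos[OF in_ball[OF that]] by (simp add: k_def)
  have "(h \<circ> (\<lambda>x. a + of_real r * x)) holomorphic_on ball 0 1"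
    by (rule holomorphic_on_compose_gen[OF _ h]) (use in_ball in \<open>auto intro!: holomorphic_intros\<close>)
  then have holk: "k holomorphic_on ball 0 1" by (simp add: o_def k_def[abs_def])
  have nz: "k x + cnj b \<noteq> 0" if "norm x < 1" for x
    using half_plane_Moebius(2)[OF k[OF that] b] .
  have holq: "q holomorphic_on ball 0 1"
    unfolding q_def using nz by (intro holomorphic_intros holk) auto
  have q0: "q 0 = 0" by (simp add: q_def k_def b_def)
  have q1: "norm (q x) < 1" if "norm x < 1" for x
    unfolding q_def using half_plane_Moebius(1)[OF k[OF that] b] .
  note S = Schwarz_Lemma'[OF holq q0 q1]
  have "(h has_field_derivative deriv h a) (at (a + of_real r * 0))"
    using h r holomorphic_derivI[of h "ball a r" a] by simp
  then have "(h \<circ> (\<lambda>x. a + of_real r * x) has_field_derivative deriv h a * of_real r) (at 0)"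
    by (rule DERIV_chain) (auto intro!: derivative_eq_intros)
  then have kd: "(k has_field_derivative deriv h a * of_real r) (at 0)"
    by (simp add: o_def k_def[abs_def])
  have bb: "b + cnj b = of_real (2 * Re b)" "k 0 = b"
    by (auto simp: k_def b_def complex_eq_iff)
  have "(q has_field_derivative deriv h a * of_real r / of_real (2 * Re b)) (at 0)"
    unfolding q_def using nz[of 0] b
    by (auto intro!: derivative_eq_intros kd simp: bb)
  then have "deriv q 0 = deriv h a * of_real r / of_real (2 * Re b)"
    by (rule DERIV_imp_deriv)
  moreover have "norm (deriv q 0) \<le> 1" using S by blast
  ultimately show "r * norm (deriv h a) \<le> 2 * Re (h a)"
    using b r by (simp add: norm_divide norm_mult b_def field_simps)
  assume x: "dist a x \<le> r / 2"
  define y where "y = (x - a) / of_real r"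
  have y: "norm y \<le> 1 / 2" "k y = h x"
    using x r by (auto simp: y_def k_def norm_divide dist_norm norm_minus_commute field_simps)
  have y1: "norm y < 1" using y(1) by simp
  have "norm (q y) \<le> norm y" using S y1 by blast
  then have "norm (q y) \<le> 1 / 2" using y(1) by linarith
  then have "2 * norm (h x - b) \<le> norm (h x + cnj b)"
    using nz[OF y1] by (simp add: q_def y(2) norm_divide field_simps)
  then have "(2 * norm (h x - b))\<^sup>2 \<le> (norm (h x + cnj b))\<^sup>2"
    by (rule power_mono) simp
  then have "4 * ((Re (h x) - Re b)\<^sup>2 + (Im (h x) - Im b)\<^sup>2) \<le> (Re (h x) + Re b)\<^sup>2 + (Im (h x) - Im b)\<^sup>2"
    unfolding power_mult_distrib cmod_power2 by simp
  then have "(2 * (Re b - Re (h x)))\<^sup>2 \<le> (Re (h x) + Re b)\<^sup>2"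
    using zero_le_power2[of "Im (h x) - Im b"]
    by (simp only: power_mult_distrib power2_commute[of "Re b"] four_x_squared[symmetric] distrib_left
        power2_eq_square[of 2])
  moreover have "0 < Re (h x)" using k[OF y1] y(2) by simp
  ultimately have "2 * (Re b - Re (h x)) \<le> Re (h x) + Re b"
    using power2_le_imp_le[of "2 * (Re b - Re (h x))" "Re (h x) + Re b"] b by linarith
  then show "Re (h a) \<le> 3 * Re (h x)" by (simp add: b_def)
qed

section \<open>Iterates and open images of entire functions\<close>

lemma holomorphic_funpow:
  assumes "f holomorphic_on UNIV"
  shows "(f ^^ n) holomorphic_on UNIV"
proof (induction n)
  case (Suc n)
  then show ?case
    using holomorphic_on_compose_gen[OF Suc assms] by (simp add: o_def)
qed (simp add: id_def)

lemma open_image_entire: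
  assumes "f holomorphic_on UNIV" "\<not> f constant_on UNIV" "open U"
  shows "open (f ` U)"
  using open_mapping_thm[OF assms(1) open_UNIV connected_UNIV assms(3) _ assms(2)] by simp

lemma open_image_funpow:
  assumes "f holomorphic_on UNIV" "\<not> f constant_on UNIV" "open U"
  shows "open ((f ^^ n) ` U)"
proof (induction n)
  case (Suc n)
  have "(f ^^ Suc n) ` U = f ` (f ^^ n) ` U" by (simp add: image_comp)
  then show ?case using open_image_entire[OF assms(1,2) Suc] by simp
qed (use assms in simp)

lemma transcendental_entire_nonconstant:
  assumes "transcendental_entire f"
  shows "\<not> f constant_on UNIV"
proof
  assume "f constant_on UNIV"
  then obtain c where "\<And>z. f z = c" by (auto simp: constant_on_def)
  then have "\<forall>z. f z = poly [:c:] z" by simp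
  then show False using assms unfolding transcendental_entire_def by blast
qed

section \<open>Escaping discs\<close>

text \<open>From some index on, the logarithmic derivative \<open>D n\<close> at a suitable point of
  the disc at least doubles at each step. Comparing expansion with the Schwarz bound for
  \<open>D (Suc n)\<close> bounds \<open>D n\<close>, a contradiction.\<close>

lemma bounded_type_no_uniform_escape:
  assumes f: "bounded_type f" and r: "0 < r"
    and esc: "\<And>K. \<exists>N. \<forall>n\<ge>N. \<forall>x\<in>ball a r. K < norm ((f ^^ n) x)"
  shows False
proof -
  have tf: "transcendental_entire f" and bdd: "bounded (singular_values f)"
    using f by (auto simp: bounded_type_def)
  then have holf: "f holomorphic_on UNIV" by (simp add: transcendental_entire_def entire_def)
  obtain R0 where R0: "\<And>s. s \<in> singular_values f \<Longrightarrow> norm s \<le> R0"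
    using bdd bounded_iff by metis
  define R where "R = max R0 (max 1 (norm (f 0)))"
  have R: "1 \<le> R" "R0 \<le> R" "norm (f 0) \<le> R" by (auto simp: R_def)
  have sub: "critical_values f \<union> asymptotic_values f \<subseteq> singular_values f"
    unfolding singular_values_def by (rule closure_subset)
  have crit: "deriv f z \<noteq> 0" if "R < norm (f z)" for z
    using R0[of "f z"] sub that R by (force simp: critical_values_def)
  have asym: "norm s \<le> R" if "s \<in> asymptotic_values f" for s
    using R0[of s] sub that R by force
  \<comment> \<open>Above the square of \<open>R\<close>, subtracting \<open>ln R\<close> loses at
    most half of \<open>ln (norm (f z))\<close>; above \<open>exp (48 * pi)\<close> the resulting
    expansion factor is at least 2.\<close>
  define K where "K = max (R\<^sup>2) (exp (48 * pi))"
  have KR: "R \<le> K" "1 \<le> K"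
  proof -
    have "R * 1 \<le> R * R" using R by (intro mult_left_mono) auto
    then show "R \<le> K" by (simp add: K_def power2_eq_square)
    then show "1 \<le> K" using R by simp
  qed
  have low: "ln (norm (f z)) / (24 * pi) \<le> norm (z * deriv f z / f z)" "2 \<le> ln (norm (f z)) / (24 * pi)"
    if z: "K < norm (f z)" for z
  proof -
    have "ln (R\<^sup>2) \<le> ln (norm (f z))" using z R by (subst ln_le_cancel_iff) (auto simp: K_def)
    then have "2 * ln R \<le> ln (norm (f z))" using R by (simp add: ln_realpow)
    moreover have "ln (norm (f z)) - ln R \<le> 12 * pi * norm (z * deriv f z / f z)"
      by (rule log_derivative_lower_bound[OF tf _ crit asym]) (use R KR z in auto)
    ultimately have "ln (norm (f z)) \<le> 24 * pi * norm (z * deriv f z / f z)" by linarith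
    then show "ln (norm (f z)) / (24 * pi) \<le> norm (z * deriv f z / f z)"
      by (simp add: pos_divide_le_eq mult.commute)
    have "ln (exp (48 * pi)) \<le> ln (norm (f z))" using z by (subst ln_le_cancel_iff) (auto simp: K_def)
    then show "2 \<le> ln (norm (f z)) / (24 * pi)" by (simp add: field_simps)
  qed
  obtain N where N: "\<And>n x. \<lbrakk>N \<le> n; x \<in> ball a r\<rbrakk> \<Longrightarrow> K < norm ((f ^^ n) x)"
    using esc by metis
  have holF: "(f ^^ n) holomorphic_on S" for n S
    using holomorphic_funpow[OF holf] holomorphic_on_subset by blast
  \<comment> \<open>Gives a nonzero starting value \<open>D N\<close>: otherwise the
    \<open>N\<close>-th iterate would be constant on the disc, contrary to openness.\<close>
  have "\<exists>b\<in>ball a r. deriv (f ^^ N) b \<noteq> 0"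
  proof (rule ccontr)
    assume "\<not> (\<exists>b\<in>ball a r. deriv (f ^^ N) b \<noteq> 0)"
    then have "deriv (f ^^ N) x = 0" if "x \<in> ball a r" for x using that by blast
    then have "((f ^^ N) has_field_derivative 0) (at x within ball a r)" if "x \<in> ball a r" for x
      using holomorphic_derivI[OF holF[of N UNIV] open_UNIV, of x] that
      by (metis UNIV_I has_field_derivative_at_within)
    then obtain c where "\<And>x. x \<in> ball a r \<Longrightarrow> (f ^^ N) x = c"
      using has_field_derivative_zero_constant[OF convex_ball] by metis
    moreover have "a \<in> ball a r" using r by simp
    ultimately have "(f ^^ N) ` ball a r = {c}" by blast
    then show False
      using open_image_funpow[OF holf transcendental_entire_nonconstant[OF tf] open_ball, of N a r]
        not_open_singleton[of c] by simp
  qed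
  then obtain b where b: "b \<in> ball a r" "deriv (f ^^ N) b \<noteq> 0" by blast
  define \<rho> where "\<rho> = r - dist a b"
  have \<rho>: "0 < \<rho>" "ball b \<rho> \<subseteq> ball a r"
    using b(1) by (auto simp: \<rho>_def ball_subset_ball_iff dist_commute)
  define D where "D n = deriv (f ^^ n) b / (f ^^ n) b" for n
  have big: "K < norm ((f ^^ n) b)" if "N \<le> n" for n
    using N[OF that b(1)] .
  \<comment> \<open>The iterate has modulus above 1 near \<open>b\<close>, so its logarithm maps
    into the right half-plane and the Schwarz estimate applies.\<close>
  have up: "\<rho> * norm (D n) \<le> 2 * ln (norm ((f ^^ n) b))" if n: "N \<le> n" for n
  proof -
    have gt1: "1 < norm ((f ^^ n) x)" if "x \<in> ball b \<rho>" for x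
      using N[OF n] \<rho>(2) that KR(2) by (meson le_less_trans subsetD)
    then have "(f ^^ n) x \<noteq> 0" if "x \<in> ball b \<rho>" for x
      using that by fastforce
    then obtain h where h: "h holomorphic_on ball b \<rho>" "\<And>x. x \<in> ball b \<rho> \<Longrightarrow> (f ^^ n) x = exp (h x)"
      using contractible_imp_holomorphic_log[OF holF convex_imp_contractible[OF convex_ball]] by metis
    have Reh: "Re (h x) = ln (norm ((f ^^ n) x))" if "x \<in> ball b \<rho>" for x
      using h(2)[OF that] by simp
    have bb: "b \<in> ball b \<rho>" using \<rho>(1) by simp
    have "(h has_field_derivative deriv h b) (at b)"
      using holomorphic_derivI[OF h(1) open_ball bb] .
    then have "((\<lambda>x. exp (h x)) has_field_derivative exp (h b) * deriv h b) (at b)"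
      by (rule DERIV_fun_exp)
    then have "((f ^^ n) has_field_derivative exp (h b) * deriv h b) (at b)"
      by (rule has_field_derivative_transform_within_open[OF _ open_ball bb]) (use h(2) in auto)
    then have "D n = deriv h b"
      using h(2)[OF bb] by (simp add: D_def DERIV_imp_deriv)
    moreover have "\<rho> * norm (deriv h b) \<le> 2 * Re (h b)"
      by (rule half_plane_Schwarz(1)[OF h(1) \<rho>(1)]) (simp add: Reh gt1 ln_gt_zero)
    ultimately show ?thesis using Reh[OF bb] by simp
  qed
  have step: "ln (norm ((f ^^ Suc n) b)) / (24 * pi) * norm (D n) \<le> norm (D (Suc n))"
    "2 * norm (D n) \<le> norm (D (Suc n))" if n: "N \<le> n" for n
  proof -
    define z where "z = (f ^^ n) b"
    have z: "z \<noteq> 0" using big[OF n] KR by (auto simp: z_def)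
    have K: "K < norm (f z)" using big[of "Suc n"] n by (simp add: z_def)
    have "(f has_field_derivative deriv f z) (at ((f ^^ n) b))"
      using holomorphic_derivI[OF holf open_UNIV UNIV_I] by (simp add: z_def)
    then have "(f \<circ> (f ^^ n) has_field_derivative deriv f z * deriv (f ^^ n) b) (at b)"
      by (rule DERIV_chain) (rule holomorphic_derivI[OF holF open_UNIV UNIV_I])
    then have "deriv (f ^^ Suc n) b = deriv f z * deriv (f ^^ n) b"
      by (simp add: DERIV_imp_deriv)
    then have "D (Suc n) = (z * deriv f z / f z) * D n"
      using z by (simp add: D_def flip: z_def)
    then have D: "norm (D (Suc n)) = norm (z * deriv f z / f z) * norm (D n)"
      by (metis norm_mult)
    have fz: "(f ^^ Suc n) b = f z" by (simp add: z_def)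
    show "ln (norm ((f ^^ Suc n) b)) / (24 * pi) * norm (D n) \<le> norm (D (Suc n))"
      unfolding D fz by (rule mult_right_mono[OF low(1)[OF K]]) simp
    show "2 * norm (D n) \<le> norm (D (Suc n))"
      unfolding D by (rule mult_right_mono) (use low[OF K] in auto)
  qed
  have bound: "norm (D n) \<le> 48 * pi / \<rho>" if n: "N \<le> n" for n
  proof -
    define L where "L = ln (norm ((f ^^ Suc n) b))"
    have "1 < norm ((f ^^ Suc n) b)" using big[of "Suc n"] n KR(2) by linarith
    then have L: "0 < L" unfolding L_def by (rule ln_gt_zero)
    have "L / (24 * pi) * norm (D n) \<le> norm (D (Suc n))" using step(1)[OF n] by (simp add: L_def)
    then have "\<rho> * (L / (24 * pi) * norm (D n)) \<le> \<rho> * norm (D (Suc n))"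
      using \<rho>(1) by (intro mult_left_mono) auto
    also have "\<dots> \<le> 2 * L" using up[of "Suc n"] n by (simp add: L_def)
    \<comment> \<open>Expansion and Schwarz bound are both proportional to \<open>L\<close>; it
      cancels, leaving a bound independent of \<open>n\<close>.\<close>
    finally have "L * (\<rho> * norm (D n)) \<le> L * (48 * pi)" by (simp add: field_simps)
    then have "\<rho> * norm (D n) \<le> 48 * pi" using L by simp
    then show ?thesis using \<rho>(1) by (simp add: field_simps)
  qed
  have grow: "2 ^ k * norm (D N) \<le> norm (D (N + k))" for k
  proof (induction k)
    case (Suc k)
    then show ?case using step(2)[of "N + k"] by simp
  qed simp
  have "D N \<noteq> 0" using b(2) big[of N] KR by (auto simp: D_def)
  then obtain k where "48 * pi / \<rho> / norm (D N) < 2 ^ k"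
    using real_arch_pow[of 2] by fastforce
  then have "48 * pi / \<rho> < 2 ^ k * norm (D N)" using \<open>D N \<noteq> 0\<close> by (subst (asm) pos_divide_less_eq) auto
  then show False using grow[of k] bound[of "N + k"] by simp
qed

text \<open>Schottky's bound keeps \<open>F n\<close> away from \<open>p\<close> near
  \<open>a\<close>. A scaled logarithm of \<open>F n - p\<close> then has positive real part, and
  Harnack spreads its size at \<open>a\<close> to a neighbourhood.\<close>

lemma omitting_two_values_imp_uniform_escape:
  assumes r: "0 < r" and hol: "\<And>n. F n holomorphic_on ball a r" and pq: "p \<noteq> q"
    and omit: "\<And>n x. x \<in> ball a r \<Longrightarrow> F n x \<noteq> p \<and> F n x \<noteq> q"
    and lim: "filterlim (\<lambda>n. F n a) at_infinity sequentially"
  obtains \<rho> where "0 < \<rho>" "\<And>K. \<exists>N. \<forall>n\<ge>N. \<forall>x\<in>ball a \<rho>. K < norm (F n x)"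
proof -
  \<comment> \<open>Normalised to omit 0 and 1: the value 1 would mean \<open>F n x = q\<close>, and
    the denominator vanishes only where \<open>F n x = p\<close>.\<close>
  define \<psi> where "\<psi> n x = (q - p) / (F n x - p)" for n :: nat and x
  define X where "X = {h. h holomorphic_on ball a r \<and> (\<forall>z\<in>ball a r. h z \<noteq> 0 \<and> h z \<noteq> 1)}"
  define Y where "Y = {h \<in> X. norm (h a) \<le> 1}"
  have \<psi>X: "\<psi> n \<in> X" for n
    unfolding X_def
  proof (intro CollectI conjI ballI)
    show "\<psi> n holomorphic_on ball a r"
      unfolding \<psi>_def using omit by (intro holomorphic_intros hol) auto
    fix z assume "z \<in> ball a r"
    then show "\<psi> n z \<noteq> 0" "\<psi> n z \<noteq> 1"
      using omit[of z n] pq by (auto simp: \<psi>_def field_simps)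
  qed
  \<comment> \<open>Schottky's theorem in family form: functions omitting 0 and 1 with modulus at
    most 1 at \<open>a\<close> share a bound near \<open>a\<close>.\<close>
  obtain B Z where B: "0 < B" "open Z" "a \<in> Z" "Z \<subseteq> ball a r"
    "\<And>h z. \<lbrakk>h \<in> Y; z \<in> Z\<rbrakk> \<Longrightarrow> norm (h z) \<le> B"
    by (rule GPicard1[of "ball a r" a 1 Y X]) (use r in \<open>auto simp: X_def Y_def\<close>)
  obtain d where d: "0 < d" "ball a d \<subseteq> Z" using B openE by blast
  \<comment> \<open>Makes \<open>c * norm (F n y - p) \<ge> 2\<close>, so the logarithm below has
    positive real part.\<close>
  define c where "c = 2 * B / norm (q - p)"
  have c: "c > 0" using B pq by (simp add: c_def)
  have Harnack: "c * norm (F n a - p) \<le> (c * norm (F n x - p)) ^ 3"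
    if n: "norm (\<psi> n a) \<le> 1" and x: "x \<in> ball a (d / 2)" for n x
  proof -
    have ge: "2 \<le> c * norm (F n y - p)" if "y \<in> ball a d" for y
    proof -
      have "norm (\<psi> n y) \<le> B" using B(5)[of "\<psi> n" y] \<psi>X n d(2) that by (auto simp: Y_def)
      moreover have "F n y \<noteq> p" using omit that d(2) B(4) by blast
      ultimately show ?thesis using pq by (simp add: \<psi>_def c_def norm_divide field_simps)
    qed
    have "(\<lambda>y. of_real c * (F n y - p)) holomorphic_on ball a d"
      using holomorphic_on_subset[OF hol] d(2) B(4) by (intro holomorphic_intros) blast
    moreover have "of_real c * (F n y - p) \<noteq> 0" if "y \<in> ball a d" for y
      using ge[OF that] by auto
    ultimately obtain h where h: "h holomorphic_on ball a d"
      "\<And>y. y \<in> ball a d \<Longrightarrow> of_real c * (F n y - p) = exp (h y)"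
      using contractible_imp_holomorphic_log[OF _ convex_imp_contractible[OF convex_ball]]
      by (metis (no_types, lifting))
    have nh: "c * norm (F n y - p) = exp (Re (h y))" if "y \<in> ball a d" for y
      using arg_cong[OF h(2)[OF that], of norm] c by (simp add: norm_mult)
    have "0 < Re (h y)" if "y \<in> ball a d" for y
    proof -
      have "1 < exp (Re (h y))" using ge[OF that] nh[OF that] by linarith
      then show ?thesis by simp
    qed
    then have "Re (h a) \<le> 3 * Re (h x)"
      using half_plane_Schwarz(2)[OF h(1) d(1)] x by simp
    then have "exp (Re (h a)) \<le> exp (Re (h x)) ^ 3"
      by (simp flip: exp_of_nat_mult)
    then show ?thesis using nh x d(1) by simp
  qed
  show thesis
  proof (rule that[of "d / 2"])
    show "0 < d / 2" using d by simp
    fix K :: real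
    \<comment> \<open>The first term ensures \<open>norm (\<psi> n a) \<le> 1\<close>; exceeding the
      second contradicts Harnack if \<open>norm (F n x) \<le> K\<close>.\<close>
    define M where "M = max (norm (q - p)) ((c * (\<bar>K\<bar> + norm p)) ^ 3 / c)"
    have "0 \<le> M" by (auto simp: M_def le_max_iff_disj)
    then have "0 < norm p + M + 1" using norm_ge_zero[of p] by linarith
    then have "eventually (\<lambda>n. norm p + M + 1 \<le> norm (F n a)) sequentially"
      using lim unfolding filterlim_at_infinity[OF order_refl] by blast
    then obtain N where N: "\<And>n. N \<le> n \<Longrightarrow> norm p + M + 1 \<le> norm (F n a)"
      unfolding eventually_sequentially by blast
    have "K < norm (F n x)" if n: "N \<le> n" and x: "x \<in> ball a (d / 2)" for n x
    proof (rule ccontr)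
      assume "\<not> K < norm (F n x)"
      then have "norm (F n x - p) \<le> \<bar>K\<bar> + norm p"
        using norm_triangle_ineq4[of "F n x" p] by linarith
      then have "(c * norm (F n x - p)) ^ 3 \<le> (c * (\<bar>K\<bar> + norm p)) ^ 3"
        using c by (intro power_mono mult_left_mono) auto
      moreover have big: "M < norm (F n a - p)"
        using N[OF n] norm_triangle_ineq2[of "F n a" p] by linarith
      then have "norm (\<psi> n a) \<le> 1"
        by (simp add: \<psi>_def norm_divide M_def divide_le_eq_1)
      from Harnack[OF this x] have "c * norm (F n a - p) \<le> (c * norm (F n x - p)) ^ 3" .
      ultimately have "c * norm (F n a - p) \<le> (c * (\<bar>K\<bar> + norm p)) ^ 3" by linarith
      then have "norm (F n a - p) \<le> (c * (\<bar>K\<bar> + norm p)) ^ 3 / c"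
        using c by (simp add: field_simps)
      then show False using big by (simp add: M_def)
    qed
    then show "\<exists>N. \<forall>n\<ge>N. \<forall>x\<in>ball a (d / 2). K < norm (F n x)" by blast
  qed
qed

section \<open>Escaping sets and commuting maps\<close>

lemma funpow_commute:
  assumes "f \<circ> g = g \<circ> f"
  shows "(f ^^ n) (g x) = g ((f ^^ n) x)"
  by (induction n) (use assms in \<open>auto simp: fun_eq_iff\<close>)

text \<open>By compactness \<open>g\<close> is bounded on each disc, so large values of
  \<open>g\<close> require large arguments.\<close>

lemma filterlim_at_infinity_of_entire_image:
  assumes g: "g holomorphic_on UNIV" and lim: "filterlim (\<lambda>n. g (x n)) at_infinity F"
  shows "filterlim x at_infinity F"
  unfolding filterlim_at_infinity[OF order_refl]
proof (intro allI impI)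
  fix r :: real
  have "compact (g ` cball 0 r)"
    using g by (intro compact_continuous_image) (auto intro: holomorphic_on_imp_continuous_on holomorphic_on_subset)
  then obtain B where B: "\<And>w. w \<in> cball 0 r \<Longrightarrow> norm (g w) \<le> B"
    using compact_imp_bounded bounded_iff by (metis imageI)
  have "eventually (\<lambda>n. \<bar>B\<bar> + 1 \<le> norm (g (x n))) F"
    using lim unfolding filterlim_at_infinity[OF order_refl] by auto
  then show "eventually (\<lambda>n. r \<le> norm (x n)) F"
  proof eventually_elim
    case (elim n)
    then show ?case using B[of "x n"] by (cases "norm (x n) \<le> r") auto
  qed
qed

lemma escaping_set_funpow_iff: "(f ^^ n) x \<in> escaping_set f \<longleftrightarrow> x \<in> escaping_set f"
proof -
  have "(f ^^ k) ((f ^^ n) x) = (f ^^ (k + n)) x" for k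
    by (simp add: funpow_add)
  then show ?thesis
    unfolding escaping_set_def filterlim_at_infinity[OF order_refl]
    using eventually_sequentially_seg[of "\<lambda>k. r \<le> norm ((f ^^ k) x)" n for r] by simp
qed

text \<open>The orbit of \<open>x\<close> stays in the escaping set and is unbounded.\<close>

lemma infinite_escaping_set:
  assumes "x \<in> escaping_set f"
  shows "infinite (escaping_set f)"
proof
  assume "finite (escaping_set f)"
  then obtain B where B: "\<And>y. y \<in> escaping_set f \<Longrightarrow> norm y \<le> B"
    using finite_imp_bounded bounded_iff by metis
  have "eventually (\<lambda>n. \<bar>B\<bar> + 1 \<le> norm ((f ^^ n) x)) sequentially"
    using assms unfolding escaping_set_def filterlim_at_infinity[OF order_refl] by auto
  then obtain n where "\<bar>B\<bar> + 1 \<le> norm ((f ^^ n) x)"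
    using eventually_happens'[OF sequentially_bot] by blast
  then show False using B[of "(f ^^ n) x"] assms escaping_set_funpow_iff by fastforce
qed

text \<open>With at most one preimage point, \<open>g\<close> takes at most one value in
  \<open>E\<close> and so omits infinitely many, against little Picard.\<close>

lemma entire_vimage_infinite_set:
  assumes g: "g holomorphic_on UNIV" "\<not> g constant_on UNIV" and "infinite E"
  shows "\<exists>p q. p \<noteq> q \<and> g p \<in> E \<and> g q \<in> E"
proof (rule ccontr)
  assume "\<not> ?thesis"
  then have eq: "u = v" if "g u \<in> E" "g v \<in> E" for u v
    using that by blast
  have "finite (range g \<inter> E)"
  proof (cases "range g \<inter> E = {}")
    case False
    then obtain u where "g u \<in> E" by blast
    then have "range g \<inter> E \<subseteq> {g u}" using eq by blast
    then show ?thesis using finite_subset by blast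
  qed simp
  then have inf: "infinite (E - range g)"
    using \<open>infinite E\<close> by (metis Diff_Diff_Int Diff_infinite_finite inf_commute)
  then obtain a where a: "a \<in> E - range g" by (metis ex_in_conv finite.emptyI)
  have "infinite (E - range g - {a})" using inf by simp
  then obtain b where b: "b \<in> E - range g - {a}" by (metis ex_in_conv finite.emptyI)
  have "range g \<inter> {a, b} = {}" "a \<noteq> b" using a b by auto
  then obtain c where "g = (\<lambda>x. c)" using little_Picard[OF g(1)] by metis
  then show False using g(2) by (auto simp: constant_on_def)
qed

text \<open>Backward invariance rests on openness of \<open>g\<close>; forward invariance holds
  because its failure would create a uniformly escaping disc.\<close>

lemma closure_escaping_set_completely_invariant:
  assumes f: "bounded_type f" and g: "g holomorphic_on UNIV" "\<not> g constant_on UNIV"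
    and comm: "f \<circ> g = g \<circ> f"
  shows "completely_invariant (closure (escaping_set f)) g"
  unfolding completely_invariant_def
proof (intro allI iffI)
  fix z
  have holf: "f holomorphic_on UNIV"
    using f by (simp add: bounded_type_def transcendental_entire_def entire_def)
  have pull: "u \<in> escaping_set f" if "g u \<in> escaping_set f" for u
    using that filterlim_at_infinity_of_entire_image[OF g(1)]
    by (simp add: escaping_set_def funpow_commute[OF comm])
  show "z \<in> closure (escaping_set f)" if z: "g z \<in> closure (escaping_set f)"
  proof -
    have "\<exists>y\<in>escaping_set f. y \<in> ball z e" if "e > 0" for e
    proof -
      have "open (g ` ball z e)" by (rule open_image_entire[OF g open_ball])
      moreover have "g z \<in> g ` ball z e" using that by simp
      ultimately have "g ` ball z e \<inter> escaping_set f \<noteq> {}"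
        using z open_Int_closure_eq_empty by fastforce
      then show ?thesis using pull by blast
    qed
    then show ?thesis unfolding closure_approachable by (auto simp: dist_commute)
  qed
  show "g z \<in> closure (escaping_set f)" if z: "z \<in> closure (escaping_set f)"
  proof (rule ccontr)
    assume neg: "g z \<notin> closure (escaping_set f)"
    define U where "U = g -` (- closure (escaping_set f))"
    have "open U"
      unfolding U_def using g(1) by (intro open_vimage) (auto intro: holomorphic_on_imp_continuous_on)
    moreover have "z \<in> U" using neg by (simp add: U_def)
    ultimately have "U \<inter> escaping_set f \<noteq> {}"
      using z open_Int_closure_eq_empty by fastforce
    then obtain a where a: "a \<in> U" "a \<in> escaping_set f" by blast
    obtain r where r: "0 < r" "ball a r \<subseteq> U" using \<open>open U\<close> a(1) openE by blast
    \<comment> \<open>Two points with escaping images; by \<open>omit\<close> below, no iterate of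
      \<open>f\<close> takes either value on the disc.\<close>
    obtain p q where pq: "p \<noteq> q" "g p \<in> escaping_set f" "g q \<in> escaping_set f"
      using entire_vimage_infinite_set[OF g infinite_escaping_set[OF a(2)]] by blast
    have omit: "g ((f ^^ n) x) \<notin> escaping_set f" if "x \<in> ball a r" for n x
    proof -
      have "g x \<notin> escaping_set f" using that r(2) closure_subset unfolding U_def by blast
      then show ?thesis using escaping_set_funpow_iff[of n f "g x"] by (simp add: funpow_commute[OF comm])
    qed
    obtain \<rho> where "0 < \<rho>" "\<And>K. \<exists>N. \<forall>n\<ge>N. \<forall>x\<in>ball a \<rho>. K < norm ((f ^^ n) x)"
    proof (rule omitting_two_values_imp_uniform_escape[OF r(1), of "\<lambda>n. f ^^ n" a p q])
      show "(f ^^ n) holomorphic_on ball a r" for n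
        using holomorphic_funpow[OF holf] holomorphic_on_subset by blast
      show "filterlim (\<lambda>n. (f ^^ n) a) at_infinity sequentially"
        using a(2) by (simp add: escaping_set_def)
      show "(f ^^ n) x \<noteq> p \<and> (f ^^ n) x \<noteq> q" if "x \<in> ball a r" for n x
        using omit[OF that, of n] pq by auto
    qed (use pq in auto)
    then show False using bounded_type_no_uniform_escape[OF f] by blast
  qed
qed

theorem theorem4:
  fixes f g :: "complex \<Rightarrow> complex"
  assumes "transcendental_entire f" and "transcendental_entire g"
    and "bounded_type f" and "bounded_type g"
    and "f \<circ> g = g \<circ> f"
  shows "completely_invariant (closure (escaping_set f)) (f \<circ> g)
       \<and> completely_invariant (closure (escaping_set g)) (f \<circ> g)"
proof -
  have hol: "f holomorphic_on UNIV" "g holomorphic_on UNIV"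
    using assms(1,2) by (auto simp: transcendental_entire_def entire_def)
  then have fg: "f \<circ> g holomorphic_on UNIV"
    using holomorphic_on_compose_gen by blast
  \<comment> \<open>A constant \<open>f \<circ> g\<close> would make this image a singleton, which
    is not open.\<close>
  have "open (f ` range g)"
    using assms(1,2) hol by (intro open_image_entire transcendental_entire_nonconstant) auto
  then have nc: "\<not> f \<circ> g constant_on UNIV"
    using not_open_singleton by (force simp: constant_on_def image_comp)
  have "f \<circ> (f \<circ> g) = (f \<circ> g) \<circ> f" "g \<circ> (f \<circ> g) = (f \<circ> g) \<circ> g"
    using assms(5) by (metis o_assoc)+
  then show ?thesis
    using closure_escaping_set_completely_invariant[OF assms(3) fg nc]
      closure_escaping_set_completely_invariant[OF assms(4) fg nc] by blast
qed

end
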